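(* There is a function $\delta$ with $\delta(\varepsilon) = \mathcal{O}_{\varepsilon \to 0}\left(\frac{\log(\log(1/\varepsilon))}{\sqrt{\log(1/\varepsilon)}}\right)$ such that the following holds. Let $w = (w_1,\ldots,w_n) \in \mathbb{Z}^n$, let $\tau \in \mathbb{Z}$, let $\alpha$ be a real number, and let $A, B \subseteq \{0,1\}^n$ be such that $|\{ i : a_i = 1\}| = \alpha n$ for each $a \in A$, and (i) $\langle w, b \rangle = \tau$ for every $b \in B$, and (ii) if $a, a' \in A$ and $\langle w,a\rangle = \langle w,a'\rangle$, then $a = a'$. If $|B| \ge 2^{(1-\varepsilon)n}$ for some $\varepsilon > 0$, then $|A| \le 2^{\delta(\varepsilon) n}$.
   Context: $\langle x, y\rangle = \sum_i x_i y_i$ denotes the standard inner product. Logarithms are base 2. We write $f(\varepsilon) = \mathcal{O}_{\varepsilon \to 0}(g(\varepsilon))$ if there are $C > 0$ and $\varepsilon_0 > 0$ with $|f(\varepsilon)| \le C g(\varepsilon)$ for all $0 < \varepsilon < \varepsilon_0$. *)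

theory Defs
  imports Complex_Main "HOL-Library.FuncSet" "HOL-Library.Landau_Symbols"
begin

text \<open>
  Vectors of length \<open>n\<close> are extensional functions on \<open>{1..n}\<close>, i.e. \<open>X\<^sup>n\<close> is
  \<open>{1..n} \<rightarrow>\<^sub>E X\<close>. Extensionality makes equality and cardinality of sets of vectors
  depend on the coordinates \<open>1, ..., n\<close> only.
\<close>

definition int_vecs :: "nat \<Rightarrow> (nat \<Rightarrow> int) set"
  where "int_vecs n = {1..n} \<rightarrow>\<^sub>E UNIV"

definition binary_vecs :: "nat \<Rightarrow> (nat \<Rightarrow> int) set"
  where "binary_vecs n = {1..n} \<rightarrow>\<^sub>E {0, 1}"

definition inner_prod :: "nat \<Rightarrow> (nat \<Rightarrow> int) \<Rightarrow> (nat \<Rightarrow> int) \<Rightarrow> int"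
  where "inner_prod n x y = (\<Sum>i=1..n. x i * y i)"

end

theory Submission
  imports Defs "HOL-Analysis.Convex" "HOL-Real_Asymp.Real_Asymp"
begin

text \<open>
  The bound holds with \<open>\<delta>(\<epsilon>) = 6 \<surd>\<epsilon>\<close>. Let \<open>D\<close> be the \<open>d\<close>-fold sumset of \<open>B\<close>. Since
  \<open>\<langle>w, a + s\<rangle> = \<langle>w, a\<rangle> + d\<tau>\<close> for \<open>s \<in> D\<close>, the sum \<open>a + s\<close> determines \<open>(a, s) \<in> A \<times> D\<close>.
  Give an integer vector \<open>s\<close> the weight \<open>Q\<^sub>d(s) = \<Prod>\<^sub>j (d choose s\<^sub>j)\<close>, the number of ways to write \<open>s\<close>
  as an ordered sum of \<open>d\<close> binary vectors. Then the weights \<open>Q\<^sub>d\<^sub>+\<^sub>1(a + s)\<close> add up to at most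
  \<open>2\<close> to the power \<open>(d + 1)n\<close>. By \<open>u exp (1 - u) \<le> 1\<close> in each coordinate, \<open>Q\<^sub>d\<^sub>+\<^sub>1(a + s)\<close> is at least
  \<open>2\<^sup>n Q\<^sub>d(s)\<close> times the exponential of an affine function of \<open>s\<close>; summed over \<open>D\<close> this dominates
  the \<open>d\<close>-th power of a sum \<open>\<Sum>\<^sub>b exp (- f b)\<close> over \<open>B\<close> with \<open>f\<close> linear. By Cauchy--Schwarz the latter is
  at least \<open>|B|\<^sup>2 / \<Sum>\<^sub>b exp (f b)\<close>, and enlarging \<open>B\<close> to the whole cube makes the denominator a
  product of hyperbolic cosines. This leaves \<open>log |A| = O((\<epsilon>d + 1/d) n)\<close>, and \<open>d \<approx> 1/\<surd>\<epsilon>\<close> balances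
  the two terms.
\<close>

section \<open>Binomial weights on integer vectors, and sumsets\<close>

text \<open>Extending the binomial coefficient by zero to all of the integers makes Pascal's rule
  hold without range conditions.\<close>

definition int_choose :: "nat \<Rightarrow> int \<Rightarrow> real"
  where "int_choose d z = (if z < 0 then 0 else real (d choose nat z))"

definition multi_choose :: "nat \<Rightarrow> nat \<Rightarrow> (nat \<Rightarrow> int) \<Rightarrow> real"
  where "multi_choose n d s = (\<Prod>j=1..n. int_choose d (s j))"

definition vec_add :: "nat \<Rightarrow> (nat \<Rightarrow> int) \<Rightarrow> (nat \<Rightarrow> int) \<Rightarrow> nat \<Rightarrow> int"
  where "vec_add n x y = (\<lambda>j\<in>{1..n}. x j + y j)"

primrec sumset :: "nat \<Rightarrow> (nat \<Rightarrow> int) set \<Rightarrow> nat \<Rightarrow> (nat \<Rightarrow> int) set" where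
  "sumset n B 0 = {\<lambda>j\<in>{1..n}. 0}"
| "sumset n B (Suc d) = (\<lambda>(b, s). vec_add n b s) ` (B \<times> sumset n B d)"

section \<open>Binomial coefficients in a single coordinate\<close>

lemma int_choose_nonneg [simp]: "0 \<le> int_choose d z"
  by (simp add: int_choose_def)

lemma int_choose_Suc: "int_choose (Suc d) z = int_choose d z + int_choose d (z - 1)"
proof -
  consider "z < 0" | "z = 0" | k where "z = int (Suc k)"
    by (metis int_cases less_int_code(1) not0_implies_Suc of_nat_0 negative_zless_0)
  then show ?thesis
  proof cases
    case (3 k)
    then have "nat z = Suc k" "nat (z - 1) = k"
      by simp_all
    with 3 show ?thesis
      by (simp add: int_choose_def)
  qed (auto simp: int_choose_def)
qed

lemma sum_int_choose: "(\<Sum>z\<in>{0..int d}. int_choose d z) = 2 ^ d"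
proof -
  have "(\<Sum>z\<in>{0..int d}. int_choose d z) = (\<Sum>k\<le>d. real (d choose k))"
    by (rule sum.reindex_bij_witness[of _ int nat]) (auto simp: int_choose_def)
  also have "\<dots> = 2 ^ d"
    using choose_row_sum[of d] by (metis of_nat_numeral of_nat_power of_nat_sum)
  finally show ?thesis .
qed

text \<open>The inequality \<open>1 + x \<le> exp x\<close> at \<open>x = u - 1\<close> gives
  \<open>u * exp (1 - u) \<le> 1\<close>. It turns a ratio \<open>u\<close> that is affine in some
  variable into the exponential of an affine function.\<close>

lemma le_mult_exp_diff:
  fixes p q u :: real
  assumes "0 \<le> p" "q = u * p"
  shows "q * exp (1 - u) \<le> p"
proof -
  have "u * exp (1 - u) \<le> exp (u - 1) * exp (1 - u)"
    using exp_ge_add_one_self[of "u - 1"] by (intro mult_right_mono) auto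
  also have "\<dots> = 1"
    by (simp flip: exp_add)
  finally have "p * (u * exp (1 - u)) \<le> p * 1"
    using assms(1) by (intro mult_left_mono) auto
  then show ?thesis
    using assms(2) by (simp add: mult_ac)
qed

text \<open>By the absorption identities, the ratio of \<open>2 * int_choose d z\<close> to
  \<open>int_choose (Suc d) (a + z)\<close> is \<open>2 * (d + 1 - z) / (d + 1)\<close> for
  \<open>a = 0\<close> and \<open>2 * (z + 1) / (d + 1)\<close> for \<open>a = 1\<close>. Both are
  affine in \<open>z\<close>, and the sign \<open>2 * a - 1\<close> merges the two cases.\<close>

lemma int_choose_Suc_ge:
  assumes "a \<in> {0, 1}"
  shows "2 * int_choose d z * exp (- (1 + (2 * a - 1) * (2 * z - d)) / (real d + 1))
           \<le> int_choose (Suc d) (a + z)"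
proof (cases "0 \<le> z \<and> z \<le> int d")
  case False
  then have "int_choose d z = 0"
    by (auto simp: int_choose_def)
  then show ?thesis by simp
next
  case True
  then obtain k where k: "z = int k" "k \<le> d"
    by (metis nonneg_int_cases of_nat_le_iff)
  show ?thesis
  proof (cases "a = 0")
    case True
    have "(Suc d - k) * (Suc d choose k) = Suc d * (d choose k)"
      using binomial_absorb_comp[of "Suc d" k] by simp
    then have "real (Suc d - k) * real (Suc d choose k) = real (Suc d) * real (d choose k)"
      by (metis of_nat_mult)
    then have eq: "2 * int_choose d z = (2 * (real d + 1 - k) / (real d + 1)) * int_choose (Suc d) z"
      using k by (simp add: int_choose_def of_nat_diff field_simps)
    have "2 * int_choose d z * exp (1 - 2 * (real d + 1 - k) / (real d + 1)) \<le> int_choose (Suc d) z"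
      by (rule le_mult_exp_diff[OF _ eq]) simp
    moreover have "1 - 2 * (real d + 1 - k) / (real d + 1) =
        - (1 + (2 * a - 1) * (2 * z - d)) / (real d + 1)"
      using True k by (simp add: field_simps)
    ultimately show ?thesis
      using True by simp
  next
    case False
    then have a: "a = 1" using assms by simp
    have "Suc k * (Suc d choose Suc k) = Suc d * (d choose k)"
      using binomial_absorption[of k "Suc d"] by simp
    then have "real (Suc k) * real (Suc d choose Suc k) = real (Suc d) * real (d choose k)"
      by (metis of_nat_mult)
    then have eq: "2 * int_choose d z = (2 * (real k + 1) / (real d + 1)) * int_choose (Suc d) (1 + z)"
      using k by (simp add: int_choose_def nat_add_distrib field_simps del: binomial_Suc_Suc)
    have "2 * int_choose d z * exp (1 - 2 * (real k + 1) / (real d + 1)) \<le> int_choose (Suc d) (1 + z)"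
      by (rule le_mult_exp_diff[OF _ eq]) simp
    moreover have "1 - 2 * (real k + 1) / (real d + 1) =
        - (1 + (2 * a - 1) * (2 * z - d)) / (real d + 1)"
      using a k by (simp add: field_simps)
    ultimately show ?thesis
      using a by simp
  qed
qed

section \<open>Product weights\<close>

lemma binary_vecs_nth: "b \<in> binary_vecs n \<Longrightarrow> j \<in> {1..n} \<Longrightarrow> b j \<in> {0, 1}"
  unfolding binary_vecs_def by (rule PiE_mem)

lemma multi_choose_nonneg [simp]: "0 \<le> multi_choose n d s"
  by (simp add: multi_choose_def prod_nonneg)

text \<open>Pascal's rule in every coordinate; expanding the product selects a binary vector
  \<open>b\<close>, one of the summands of \<open>r\<close>.\<close>

lemma multi_choose_Suc:
  "multi_choose n (Suc d) r = (\<Sum>b\<in>binary_vecs n. multi_choose n d (\<lambda>j. r j - b j))"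
proof -
  have "multi_choose n (Suc d) r = (\<Prod>j=1..n. \<Sum>x\<in>{0, 1}. int_choose d (r j - x))"
    by (simp add: multi_choose_def int_choose_Suc)
  also have "\<dots> = (\<Sum>b\<in>binary_vecs n. \<Prod>j=1..n. int_choose d (r j - b j))"
    unfolding binary_vecs_def by (rule prod_sum_PiE) auto
  finally show ?thesis
    by (simp add: multi_choose_def)
qed

lemma sum_multi_choose: "(\<Sum>s\<in>{1..n} \<rightarrow>\<^sub>E {0..int d}. multi_choose n d s) = 2 ^ (d * n)"
proof -
  have "(\<Sum>s\<in>{1..n} \<rightarrow>\<^sub>E {0..int d}. multi_choose n d s) =
      (\<Prod>j=1..n. \<Sum>z\<in>{0..int d}. int_choose d z)"
    unfolding multi_choose_def by (rule prod_sum_PiE[symmetric]) auto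
  also have "\<dots> = 2 ^ (d * n)"
    by (simp add: sum_int_choose power_mult)
  finally show ?thesis .
qed

text \<open>Product of the one-coordinate bounds. The exponent is written through
  \<open>2 * s j - d\<close> because this is a sum of \<open>d\<close> signs
  \<open>2 * b j - 1\<close> when \<open>s\<close> is a sum of \<open>d\<close> binary vectors, so
  the exponential factors over the summands.\<close>

lemma multi_choose_Suc_ge:
  fixes a s :: "nat \<Rightarrow> int" and t :: real
  assumes "a \<in> binary_vecs n" and t_def: "t = 1 / (real d + 1)"
  shows "2 ^ n * exp (- (n * t)) *
      (multi_choose n d s * exp (\<Sum>j=1..n. - t * (2 * a j - 1) * (2 * s j - d)))
    \<le> multi_choose n (Suc d) (vec_add n a s)"
proof -
  have "(\<Prod>j=1..n. 2 * int_choose d (s j) * exp (- (1 + (2 * a j - 1) * (2 * s j - d)) / (real d + 1)))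
      \<le> (\<Prod>j=1..n. int_choose (Suc d) (vec_add n a s j))"
  proof (rule prod_mono, intro conjI)
    fix j assume j: "j \<in> {1..n}"
    then have "a j \<in> {0, 1}"
      using assms(1) by (rule binary_vecs_nth[rotated])
    from int_choose_Suc_ge[OF this, of d "s j"] j
    show "2 * int_choose d (s j) * exp (- (1 + (2 * a j - 1) * (2 * s j - d)) / (real d + 1))
        \<le> int_choose (Suc d) (vec_add n a s j)"
      by (simp add: vec_add_def)
  qed simp
  also have "(\<lambda>j. - (1 + (2 * a j - 1) * (2 * s j - d)) / (real d + 1)) =
      (\<lambda>j. - t + - t * (2 * a j - 1) * (2 * s j - d))"
    by (simp add: t_def fun_eq_iff field_simps)
  then have "(\<Prod>j=1..n. 2 * int_choose d (s j) *
        exp (- (1 + (2 * a j - 1) * (2 * s j - d)) / (real d + 1))) =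
      (\<Prod>j=1..n. 2 * int_choose d (s j) *
        (exp (- t) * exp (- t * (2 * a j - 1) * (2 * s j - d))))"
    by (simp add: fun_eq_iff flip: exp_add)
  also have "\<dots> = 2 ^ n * exp (- (n * t)) *
      (multi_choose n d s * exp (\<Sum>j=1..n. - t * (2 * a j - 1) * (2 * s j - d)))"
  proof -
    have "exp (- t) ^ n = exp (- (n * t))"
      by (simp flip: exp_of_nat_mult)
    then show ?thesis
      by (simp only: multi_choose_def prod.distrib prod_constant card_atLeastAtMost
          exp_sum finite_atLeastAtMost) simp
  qed
  finally show ?thesis
    by (simp add: multi_choose_def)
qed

section \<open>Sumsets and their inner products with \<open>w\<close>\<close>

lemma finite_binary_vecs [simp]: "finite (binary_vecs n)"
  by (simp add: binary_vecs_def finite_PiE)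

lemma finite_sumset: "finite B \<Longrightarrow> finite (sumset n B d)"
  by (induction d) auto

lemma sumset_subset:
  assumes "B \<subseteq> binary_vecs n"
  shows "sumset n B d \<subseteq> {1..n} \<rightarrow>\<^sub>E {0..int d}"
proof (induction d)
  case (Suc d)
  have "vec_add n b s \<in> {1..n} \<rightarrow>\<^sub>E {0..int (Suc d)}" if "b \<in> B" "s \<in> sumset n B d" for b s
    unfolding vec_add_def
  proof (rule restrict_PiE_iff[THEN iffD2], rule ballI)
    fix j assume j: "j \<in> {1..n}"
    have "b j \<in> {0, 1}"
      using assms that(1) j by (intro binary_vecs_nth) auto
    moreover have "s j \<in> {0..int d}"
      using Suc that(2) j by (auto simp: PiE_iff)
    ultimately show "b j + s j \<in> {0..int (Suc d)}"
      by auto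
  qed
  then show ?case
    by auto
qed auto

lemma inner_prod_vec_add:
  "inner_prod n w (vec_add n x y) = inner_prod n w x + inner_prod n w y"
proof -
  have "inner_prod n w (vec_add n x y) = (\<Sum>j=1..n. w j * x j + w j * y j)"
    unfolding Defs.inner_prod_def by (rule sum.cong) (auto simp: vec_add_def algebra_simps)
  then show ?thesis
    by (simp add: Defs.inner_prod_def sum.distrib)
qed

lemma inner_prod_sumset:
  assumes "\<forall>b\<in>B. inner_prod n w b = \<tau>" "s \<in> sumset n B d"
  shows "inner_prod n w s = int d * \<tau>"
  using assms(2)
proof (induction d arbitrary: s)
  case 0
  then have "inner_prod n w s = (\<Sum>j=1..n. w j * 0)"
    unfolding Defs.inner_prod_def by (intro sum.cong[OF refl]) auto
  then show ?case by simp
next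
  case (Suc d)
  then show ?case
    using assms(1) by (auto simp: inner_prod_vec_add algebra_simps)
qed

lemma vec_add_cancel:
  assumes "x \<in> extensional {1..n}" "y \<in> extensional {1..n}" "vec_add n b x = vec_add n b y"
  shows "x = y"
proof (rule extensionalityI[OF assms(1,2)])
  fix j assume "j \<in> {1..n}"
  then show "x j = y j"
    using fun_cong[OF assms(3), of j] by (simp add: vec_add_def)
qed

section \<open>Exponential sums over a sumset and over the cube\<close>

text \<open>Expanding the power gives a sum over \<open>d\<close>-tuples from \<open>B\<close> whose
  terms depend only on the total \<open>s\<close>, and at most \<open>multi_choose n d s\<close>
  tuples have total \<open>s\<close>. The induction splits off one summand at a time.\<close>

lemma power_sum_exp_le_sumset:
  fixes c :: "nat \<Rightarrow> real"
  assumes B: "B \<subseteq> binary_vecs n"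
  shows "(\<Sum>b\<in>B. exp (\<Sum>j=1..n. c j * (2 * b j - 1))) ^ d
    \<le> (\<Sum>s\<in>sumset n B d. multi_choose n d s * exp (\<Sum>j=1..n. c j * (2 * s j - d)))"
proof (induction d)
  case 0
  then show ?case by (simp add: multi_choose_def int_choose_def)
next
  case (Suc d)
  define e where "e d s = exp (\<Sum>j=1..n. c j * (2 * real_of_int (s j) - real d))"
    for d and s :: "nat \<Rightarrow> int"
  have finB: "finite B"
    using B finite_binary_vecs by (rule finite_subset)
  have fin: "finite (sumset n B d)" for d
    using finB by (rule finite_sumset)
  have e_add: "e (Suc d) (vec_add n b s) = e 1 b * e d s" for b s
    unfolding e_def exp_add[symmetric] sum.distrib[symmetric]
    by (intro arg_cong[where f = exp] sum.cong) (auto simp: vec_add_def algebra_simps)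
  have IH: "(\<Sum>b\<in>B. e 1 b) ^ d \<le> (\<Sum>s\<in>sumset n B d. multi_choose n d s * e d s)"
    using Suc by (simp add: e_def)
  have "(\<Sum>b\<in>B. e 1 b) ^ Suc d
      \<le> (\<Sum>b\<in>B. e 1 b) * (\<Sum>s\<in>sumset n B d. multi_choose n d s * e d s)"
    using IH by (simp add: mult_left_mono sum_nonneg e_def)
  also have "\<dots> = (\<Sum>(b, s)\<in>B \<times> sumset n B d. multi_choose n d s * e (Suc d) (vec_add n b s))"
    by (simp add: sum_product sum.cartesian_product e_add mult_ac)
  \<comment> \<open>Pairs are grouped by their sum \<open>r\<close>.\<close>
  also have "\<dots> = (\<Sum>r\<in>sumset n B (Suc d). \<Sum>(b, s)\<in>{p \<in> B \<times> sumset n B d. (\<lambda>(b, s). vec_add n b s) p = r}.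
      multi_choose n d s * e (Suc d) (vec_add n b s))"
    using finB fin by (intro sum.group[symmetric]) auto
  also have "\<dots> \<le> (\<Sum>r\<in>sumset n B (Suc d). multi_choose n (Suc d) r * e (Suc d) r)"
  proof (rule sum_mono)
    fix r assume "r \<in> sumset n B (Suc d)"
    define P where "P = {p \<in> B \<times> sumset n B d. (\<lambda>(b, s). vec_add n b s) p = r}"
    have "(\<Sum>(b, s)\<in>P. multi_choose n d s * e (Suc d) (vec_add n b s)) =
        (\<Sum>p\<in>P. multi_choose n d (\<lambda>j. r j - fst p j)) * e (Suc d) r"
      unfolding sum_distrib_right
    proof (rule sum.cong)
      fix p assume "p \<in> P"
      then have "vec_add n (fst p) (snd p) = r"
        by (auto simp: P_def)
      moreover from this have "multi_choose n d (snd p) = multi_choose n d (\<lambda>j. r j - fst p j)"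
        unfolding multi_choose_def by (intro prod.cong) (auto simp: vec_add_def)
      ultimately show "(case p of (b, s) \<Rightarrow> multi_choose n d s * e (Suc d) (vec_add n b s)) =
          multi_choose n d (\<lambda>j. r j - fst p j) * e (Suc d) r"
        by (simp add: case_prod_beta)
    qed simp
    \<comment> \<open>Within the fibre over \<open>r\<close>, the first component determines the
      second, so the fibre can be indexed by binary vectors and compared with the full recursion for
      \<open>multi_choose\<close>.\<close>
    also have "(\<Sum>p\<in>P. multi_choose n d (\<lambda>j. r j - fst p j)) =
        (\<Sum>b\<in>fst ` P. multi_choose n d (\<lambda>j. r j - b j))"
    proof (rule sum.reindex_cong[symmetric])
      show "inj_on fst P"
      proof (rule inj_onI)
        fix p q assume *: "p \<in> P" "q \<in> P" "fst p = fst q"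
        have "snd p \<in> extensional {1..n}" "snd q \<in> extensional {1..n}"
          using * sumset_subset[OF B, of d] by (auto simp: P_def PiE_iff)
        then have "snd p = snd q"
          by (rule vec_add_cancel[of _ _ _ "fst p"]) (use * in \<open>auto simp: P_def\<close>)
        with *(3) show "p = q"
          by (simp add: prod_eq_iff)
      qed
    qed auto
    also have "\<dots> \<le> multi_choose n (Suc d) r"
      unfolding multi_choose_Suc using B by (intro sum_mono2) (auto simp: P_def)
    finally show "(\<Sum>(b, s)\<in>P. multi_choose n d s * e (Suc d) (vec_add n b s))
        \<le> multi_choose n (Suc d) r * e (Suc d) r"
      by (simp add: mult_right_mono e_def)
  qed
  finally show ?case
    by (simp add: e_def)
qed

text \<open>The linear terms cancel between \<open>exp t \<le> 1 + t + t\<^sup>2\<close> and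
  \<open>exp (- t) \<le> 1 / (1 + t) \<le> 1 - t + t\<^sup>2\<close>.\<close>

lemma exp_plus_exp_minus_le:
  fixes t :: real
  assumes "0 \<le> t" "t \<le> 1"
  shows "exp t + exp (- t) \<le> 2 * exp (t\<^sup>2)"
proof -
  have "exp (- t) = 1 / exp t"
    by (simp add: exp_minus field_simps)
  also have "\<dots> \<le> 1 / (1 + t)"
    using assms exp_ge_add_one_self[of t] by (intro divide_left_mono) auto
  also have "\<dots> \<le> 1 - t + t\<^sup>2"
  proof -
    have "(1 - t + t\<^sup>2) * (1 + t) = 1 + t ^ 3"
      by (simp add: algebra_simps power2_eq_square power3_eq_cube)
    then show ?thesis
      using assms by (simp add: divide_le_eq)
  qed
  finally have "exp t + exp (- t) \<le> 2 * (1 + t\<^sup>2)"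
    using exp_bound[OF assms] by simp
  also have "\<dots> \<le> 2 * exp (t\<^sup>2)"
    by (intro mult_left_mono exp_ge_add_one_self) simp
  finally show ?thesis .
qed

text \<open>The sum factors over coordinates. Since \<open>2 * a j - 1\<close> is a sign, each
  factor is \<open>exp t + exp (- t)\<close>, whatever \<open>a\<close> is.\<close>

lemma sum_exp_binary_vecs_le:
  fixes a :: "nat \<Rightarrow> int" and t :: real
  assumes a: "a \<in> binary_vecs n" and t: "0 \<le> t" "t \<le> 1"
  shows "(\<Sum>b\<in>binary_vecs n. exp (\<Sum>j=1..n. t * (2 * a j - 1) * (2 * b j - 1)))
    \<le> (2 * exp (t\<^sup>2)) ^ n"
proof -
  have "(\<Sum>b\<in>binary_vecs n. exp (\<Sum>j=1..n. t * (2 * a j - 1) * (2 * b j - 1))) =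
      (\<Prod>j=1..n. \<Sum>x\<in>{0, 1::int}. exp (t * (2 * a j - 1) * (2 * x - 1)))"
    unfolding binary_vecs_def exp_sum[OF finite_atLeastAtMost]
    by (rule prod_sum_PiE[symmetric]) auto
  also have "\<dots> \<le> (\<Prod>j=1..n. 2 * exp (t\<^sup>2))"
  proof (rule prod_mono, intro conjI)
    fix j assume "j \<in> {1..n}"
    then have "a j = 0 \<or> a j = 1"
      using binary_vecs_nth[OF a] by auto
    then show "(\<Sum>x\<in>{0, 1::int}. exp (t * (2 * a j - 1) * (2 * x - 1))) \<le> 2 * exp (t\<^sup>2)"
      using exp_plus_exp_minus_le[OF t] by auto
  qed (simp add: sum_nonneg)
  finally show ?thesis by simp
qed

text \<open>Cauchy-Schwarz for \<open>exp (- f b / 2)\<close> and \<open>exp (f b / 2)\<close>,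
  whose product is 1.\<close>

lemma card_power2_le_sum_exp_minus:
  fixes f :: "'a \<Rightarrow> real"
  shows "(real (card B))\<^sup>2 \<le> (\<Sum>b\<in>B. exp (- f b)) * (\<Sum>b\<in>B. exp (f b))"
proof -
  have "exp (- (f b / 2)) * exp (f b / 2) = 1" "(exp (- (f b / 2)))\<^sup>2 = exp (- f b)"
    "(exp (f b / 2))\<^sup>2 = exp (f b)" for b
    by (simp_all flip: exp_add exp_double)
  then show ?thesis
    using Cauchy_Schwarz_ineq_sum[of "\<lambda>b. exp (- (f b / 2))" "\<lambda>b. exp (f b / 2)" B] by simp
qed

section \<open>Bounding the size of \<open>A\<close>\<close>

text \<open>The sums \<open>a + s\<close> are distinct points of a grid of total weight
  \<open>2 ^ ((d + 1) * n)\<close>, and each fixed \<open>a\<close> accounts for weight at least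
  \<open>2 ^ n * exp (- n / (d + 1)) * M ^ d\<close>.\<close>

lemma card_mult_le:
  fixes w :: "nat \<Rightarrow> int"
  assumes A: "A \<subseteq> binary_vecs n" and B: "B \<subseteq> binary_vecs n"
    and level: "\<forall>b\<in>B. inner_prod n w b = \<tau>"
    and inj: "\<forall>a\<in>A. \<forall>a'\<in>A. inner_prod n w a = inner_prod n w a' \<longrightarrow> a = a'"
    and M: "\<And>a. a \<in> A \<Longrightarrow>
      M \<le> (\<Sum>b\<in>B. exp (\<Sum>j=1..n. - (1 / (real d + 1)) * (2 * a j - 1) * (2 * b j - 1)))"
    and "0 \<le> M"
  shows "card A * (exp (- (n / (real d + 1))) * M ^ d) \<le> 2 ^ (d * n)"
proof -
  define t where "t = 1 / (real d + 1)"
  have inj': "inj_on (\<lambda>(a, s). vec_add n a s) (A \<times> sumset n B d)"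
  proof (rule inj_onI, clarify)
    fix a s a' s'
    assume *: "a \<in> A" "s \<in> sumset n B d" "a' \<in> A" "s' \<in> sumset n B d"
      and eq: "vec_add n a s = vec_add n a' s'"
    \<comment> \<open>All of \<open>sumset n B d\<close> lies on the level
      \<open>d * \<tau>\<close>, so the sum reveals the inner product of \<open>w\<close> with
      \<open>a\<close>, hence \<open>a\<close>, and then \<open>s\<close>.\<close>
    have "inner_prod n w a + int d * \<tau> = inner_prod n w a' + int d * \<tau>"
      using arg_cong[OF eq, of "inner_prod n w"] *
      by (simp add: inner_prod_vec_add inner_prod_sumset[OF level])
    then have "a = a'"
      using inj * by simp
    moreover have "s \<in> extensional {1..n}" "s' \<in> extensional {1..n}"
      using * sumset_subset[OF B, of d] by (auto simp: PiE_iff)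
    ultimately show "a = a' \<and> s = s'"
      using eq vec_add_cancel by blast
  qed
  have "vec_add n a s \<in> sumset n (binary_vecs n) (Suc d)" if "a \<in> A" "s \<in> sumset n B d" for a s
  proof -
    have "sumset n B k \<subseteq> sumset n (binary_vecs n) k" for k
      by (induction k) (use B in auto)
    then show ?thesis
      using that A by auto
  qed
  then have sub: "(\<lambda>(a, s). vec_add n a s) ` (A \<times> sumset n B d) \<subseteq> {1..n} \<rightarrow>\<^sub>E {0..int (Suc d)}"
    using sumset_subset[of "binary_vecs n" n "Suc d"] by auto
  have "card A * (2 ^ n * exp (- (n * t)) * M ^ d) = (\<Sum>a\<in>A. 2 ^ n * exp (- (n * t)) * M ^ d)"
    by simp
  also have "\<dots> \<le> (\<Sum>a\<in>A. \<Sum>s\<in>sumset n B d. multi_choose n (Suc d) (vec_add n a s))"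
  proof (rule sum_mono)
    fix a assume a: "a \<in> A"
    then have a': "a \<in> binary_vecs n"
      using A by auto
    have "M ^ d \<le> (\<Sum>b\<in>B. exp (\<Sum>j=1..n. - t * (2 * a j - 1) * (2 * b j - 1))) ^ d"
      using M[OF a] \<open>0 \<le> M\<close> unfolding t_def by (intro power_mono) auto
    also have "\<dots> \<le> (\<Sum>s\<in>sumset n B d. multi_choose n d s *
        exp (\<Sum>j=1..n. - t * (2 * a j - 1) * (2 * s j - d)))"
      using power_sum_exp_le_sumset[OF B, of "\<lambda>j. - t * (2 * a j - 1)"] by simp
    finally have "2 ^ n * exp (- (n * t)) * M ^ d \<le> 2 ^ n * exp (- (n * t)) *
        (\<Sum>s\<in>sumset n B d. multi_choose n d s *
        exp (\<Sum>j=1..n. - t * (2 * a j - 1) * (2 * s j - d)))"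
      by (intro mult_left_mono) auto
    also have "\<dots> \<le> (\<Sum>s\<in>sumset n B d. multi_choose n (Suc d) (vec_add n a s))"
      unfolding sum_distrib_left using a' t_def by (intro sum_mono multi_choose_Suc_ge)
    finally show "2 ^ n * exp (- (n * t)) * M ^ d
        \<le> (\<Sum>s\<in>sumset n B d. multi_choose n (Suc d) (vec_add n a s))" .
  qed
  also have "\<dots> = (\<Sum>(a, s)\<in>A \<times> sumset n B d. multi_choose n (Suc d) (vec_add n a s))"
    by (simp add: sum.cartesian_product)
  also have "\<dots> = (\<Sum>r\<in>(\<lambda>(a, s). vec_add n a s) ` (A \<times> sumset n B d). multi_choose n (Suc d) r)"
    by (subst sum.reindex[OF inj']) (simp add: case_prod_beta o_def)
  also have "\<dots> \<le> (\<Sum>r\<in>{1..n} \<rightarrow>\<^sub>E {0..int (Suc d)}. multi_choose n (Suc d) r)"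
    using sub by (intro sum_mono2) (auto intro: finite_PiE)
  also have "\<dots> = 2 ^ n * 2 ^ (d * n)"
    unfolding sum_multi_choose by (simp add: power_add)
  finally show ?thesis
    by (simp add: t_def)
qed

text \<open>Powers of 2 leave \<open>d * n - (1 - 2 * \<epsilon>) * n * d = 2 * \<epsilon> * d *
  n\<close>; the weight comparison and the cosh bound each cost at most a factor
  \<open>exp (n / (d + 1))\<close>.\<close>

lemma card_le_of_level_set:
  fixes w :: "nat \<Rightarrow> int"
  assumes A: "A \<subseteq> binary_vecs n" and B: "B \<subseteq> binary_vecs n"
    and level: "\<forall>b\<in>B. inner_prod n w b = \<tau>"
    and inj: "\<forall>a\<in>A. \<forall>a'\<in>A. inner_prod n w a = inner_prod n w a' \<longrightarrow> a = a'"
    and large: "2 powr ((1 - \<epsilon>) * n) \<le> card B"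
  shows "card A \<le> 2 powr (2 * \<epsilon> * d * n) * exp (2 * real n / (real d + 1))"
proof -
  define t where "t = 1 / (real d + 1)"
  have t: "0 \<le> t" "t \<le> 1"
    by (auto simp: t_def)
  \<comment> \<open>This keeps the factor \<open>exp (- (n * t\<^sup>2 * d))\<close> occurring in
    \<open>M ^ d\<close> above \<open>exp (- (n * t))\<close>.\<close>
  have td: "t\<^sup>2 * d \<le> t"
  proof -
    have "t * d \<le> 1"
      by (simp add: t_def)
    then have "t * (t * d) \<le> t * 1"
      using t(1) by (rule mult_left_mono)
    then show ?thesis
      by (simp add: power2_eq_square mult.assoc)
  qed
  \<comment> \<open>The lower bound for the square of \<open>card B\<close>, divided by the cube
    bound \<open>(2 * exp (t\<^sup>2)) ^ n\<close>; the exponent is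
    \<open>2 * (1 - \<epsilon>) - 1 = 1 - 2 * \<epsilon>\<close>.\<close>
  define M where "M = 2 powr ((1 - 2 * \<epsilon>) * n) * exp (- (n * t\<^sup>2))"
  have "M \<le> (\<Sum>b\<in>B. exp (\<Sum>j=1..n. - t * (2 * a j - 1) * (2 * b j - 1)))" if "a \<in> A" for a
  proof -
    define f where "f b = (\<Sum>j=1..n. t * (2 * a j - 1) * (2 * real_of_int (b j) - 1))"
      for b :: "nat \<Rightarrow> int"
    have "(\<Sum>b\<in>B. exp (f b)) \<le> (\<Sum>b\<in>binary_vecs n. exp (f b))"
      using B by (intro sum_mono2) auto
    also have "\<dots> \<le> (2 * exp (t\<^sup>2)) ^ n"
      using sum_exp_binary_vecs_le[of a n t] that A t by (auto simp: f_def)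
    finally have S: "(\<Sum>b\<in>B. exp (f b)) \<le> (2 * exp (t\<^sup>2)) ^ n" .
    have "(2 powr ((1 - \<epsilon>) * n))\<^sup>2 \<le> (real (card B))\<^sup>2"
      using large by (intro power_mono) auto
    also have "\<dots> \<le> (\<Sum>b\<in>B. exp (- f b)) * (\<Sum>b\<in>B. exp (f b))"
      by (rule card_power2_le_sum_exp_minus)
    also have "\<dots> \<le> (\<Sum>b\<in>B. exp (- f b)) * (2 * exp (t\<^sup>2)) ^ n"
      using S by (intro mult_left_mono sum_nonneg) auto
    finally have "(2 powr ((1 - \<epsilon>) * n))\<^sup>2 \<le> (\<Sum>b\<in>B. exp (- f b)) * (2 * exp (t\<^sup>2)) ^ n" .
    moreover have "(2 powr ((1 - \<epsilon>) * n))\<^sup>2 = M * (2 * exp (t\<^sup>2)) ^ n"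
    proof -
      have "(2 powr ((1 - \<epsilon>) * n))\<^sup>2 = 2 powr ((1 - 2 * \<epsilon>) * n) * 2 powr n"
        by (simp add: power2_eq_square algebra_simps flip: powr_add)
      also have "\<dots> = M * (2 powr n * exp (n * t\<^sup>2))"
        by (simp add: M_def exp_minus)
      also have "\<dots> = M * (2 * exp (t\<^sup>2)) ^ n"
        by (simp add: power_mult_distrib powr_realpow exp_of_nat_mult)
      finally show ?thesis .
    qed
    ultimately have "M \<le> (\<Sum>b\<in>B. exp (- f b))"
      by simp
    then show ?thesis
      by (simp add: f_def sum_negf)
  qed
  then have main: "card A * (exp (- (n / (real d + 1))) * M ^ d) \<le> 2 ^ (d * n)"
    by (intro card_mult_le[OF A B level inj]) (auto simp: t_def M_def)
  have "M ^ d = 2 powr ((1 - 2 * \<epsilon>) * n * d) * exp (- (n * t\<^sup>2 * d))"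
    by (simp add: M_def power_mult_distrib powr_powr mult_ac flip: powr_realpow exp_of_nat_mult)
  moreover have "n * t\<^sup>2 * d \<le> n * t"
    using mult_left_mono[OF td, of n] by (simp add: mult_ac)
  ultimately have "2 powr ((1 - 2 * \<epsilon>) * n * d) * exp (- (n * t)) \<le> M ^ d"
    by simp
  then have "card A * (exp (- (n * t)) * (2 powr ((1 - 2 * \<epsilon>) * n * d) * exp (- (n * t))))
      \<le> card A * (exp (- (n * t)) * M ^ d)"
    by (intro mult_left_mono) auto
  also have "\<dots> \<le> 2 powr (d * n)"
    using main by (simp add: t_def powr_realpow flip: of_nat_mult)
  finally have *: "card A * (exp (- (n * t)) * (2 powr ((1 - 2 * \<epsilon>) * n * d) * exp (- (n * t))))
      \<le> 2 powr (d * n)" .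
  have "exp (- (n * t)) * exp (- (n * t)) * exp (2 * n * t) = 1"
    by (simp flip: exp_add)
  moreover have "(2::real) powr p * 2 powr (- p) = 1" for p
    by (simp flip: powr_add)
  ultimately have "real (card A) = card A * (exp (- (n * t)) * exp (- (n * t)) * exp (2 * n * t)) *
      (2 powr ((1 - 2 * \<epsilon>) * n * d) * 2 powr (- ((1 - 2 * \<epsilon>) * n * d)))"
    by (simp only: mult_1_right)
  also have "\<dots> = card A * (exp (- (n * t)) * (2 powr ((1 - 2 * \<epsilon>) * n * d) * exp (- (n * t)))) *
      (2 powr (- ((1 - 2 * \<epsilon>) * n * d)) * exp (2 * n * t))"
    by (simp only: mult_ac)
  also have "\<dots> \<le> 2 powr (d * n) * (2 powr (- ((1 - 2 * \<epsilon>) * n * d)) * exp (2 * n * t))"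
    using * by (intro mult_right_mono) auto
  also have "\<dots> = 2 powr (2 * \<epsilon> * d * n) * exp (2 * real n / (real d + 1))"
    by (simp add: t_def algebra_simps flip: powr_add)
  finally show ?thesis .
qed

theorem theorem4p1:
  "\<exists>\<delta> :: real \<Rightarrow> real.
     \<delta> \<in> O[at_right 0](\<lambda>\<epsilon>. log 2 (log 2 (1 / \<epsilon>)) / sqrt (log 2 (1 / \<epsilon>))) \<and>
     (\<forall>(n :: nat) (w :: nat \<Rightarrow> int) (\<tau> :: int) (\<alpha> :: real)
        (A :: (nat \<Rightarrow> int) set) (B :: (nat \<Rightarrow> int) set) (\<epsilon> :: real).
        w \<in> int_vecs n \<longrightarrow>
        A \<subseteq> binary_vecs n \<longrightarrow>
        B \<subseteq> binary_vecs n \<longrightarrow>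
        (\<forall>a\<in>A. real (card {i \<in> {1..n}. a i = 1}) = \<alpha> * real n) \<longrightarrow>
        (\<forall>b\<in>B. inner_prod n w b = \<tau>) \<longrightarrow>
        (\<forall>a\<in>A. \<forall>a'\<in>A. inner_prod n w a = inner_prod n w a' \<longrightarrow> a = a') \<longrightarrow>
        \<epsilon> > 0 \<longrightarrow>
        real (card B) \<ge> 2 powr ((1 - \<epsilon>) * real n) \<longrightarrow>
        real (card A) \<le> 2 powr (\<delta> \<epsilon> * real n))"
\<comment> \<open>The constant is \<open>6 = 2 + 4\<close>: the terms
  \<open>2 * \<epsilon> * d\<close> and \<open>4 / (d + 1)\<close> are at most
  \<open>2 * sqrt \<epsilon>\<close> and \<open>4 * sqrt \<epsilon>\<close>.\<close>
proof (intro exI[of _ "\<lambda>\<epsilon>. 6 * sqrt \<epsilon>"] conjI allI impI)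
  show "(\<lambda>\<epsilon>::real. 6 * sqrt \<epsilon>)
      \<in> O[at_right 0](\<lambda>\<epsilon>. log 2 (log 2 (1 / \<epsilon>)) / sqrt (log 2 (1 / \<epsilon>)))"
    by real_asymp
next
  fix n :: nat and w :: "nat \<Rightarrow> int" and \<tau> :: int
    and A B :: "(nat \<Rightarrow> int) set" and \<epsilon> :: real
  assume A: "A \<subseteq> binary_vecs n" and B: "B \<subseteq> binary_vecs n"
    and level: "\<forall>b\<in>B. inner_prod n w b = \<tau>"
    and inj: "\<forall>a\<in>A. \<forall>a'\<in>A. inner_prod n w a = inner_prod n w a' \<longrightarrow> a = a'"
    and \<epsilon>: "\<epsilon> > 0" and large: "real (card B) \<ge> 2 powr ((1 - \<epsilon>) * real n)"
  \<comment> \<open>For \<open>\<epsilon> > 1\<close> this is \<open>d = 0\<close>, which the bounds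
    below permit.\<close>
  define d where "d = nat \<lfloor>1 / sqrt \<epsilon>\<rfloor>"
  have "real d \<le> 1 / sqrt \<epsilon>" "1 / sqrt \<epsilon> \<le> real d + 1"
    using \<epsilon> by (auto simp: d_def)
  then have "sqrt \<epsilon> * d \<le> 1" and t: "1 / (real d + 1) \<le> sqrt \<epsilon>"
    using \<epsilon> by (simp_all add: field_simps)
  then have "sqrt \<epsilon> * (sqrt \<epsilon> * d) \<le> sqrt \<epsilon> * 1"
    using \<epsilon> by (intro mult_left_mono) auto
  then have \<epsilon>d: "\<epsilon> * d \<le> sqrt \<epsilon>"
    using \<epsilon> by (simp flip: mult.assoc)
  \<comment> \<open>Base \<open>exp 1\<close> is replaced by 2 through
    \<open>exp 1 \<le> 3 \<le> 2 powr 2\<close>, which doubles the exponent.\<close>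
  have "exp 1 powr (2 * n / (real d + 1)) \<le> (2 powr 2) powr (2 * n / (real d + 1))"
    using exp_le by (intro powr_mono2) auto
  then have exp: "exp (2 * n / (real d + 1)) \<le> 2 powr (4 * n / (real d + 1))"
    unfolding powr_powr by (simp add: exp_powr_real)
  have "card A \<le> 2 powr (2 * \<epsilon> * d * n) * exp (2 * real n / (real d + 1))"
    by (rule card_le_of_level_set[OF A B level inj large])
  also have "\<dots> \<le> 2 powr (2 * \<epsilon> * d * n) * 2 powr (4 * n / (real d + 1))"
    using exp by (intro mult_left_mono) auto
  also have "\<dots> = 2 powr ((2 * (\<epsilon> * d) + 4 * (1 / (real d + 1))) * n)"
    by (simp add: algebra_simps flip: powr_add)
  also have "\<dots> \<le> 2 powr (6 * sqrt \<epsilon> * n)"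
    using \<epsilon>d t by (intro powr_mono mult_right_mono) auto
  finally show "real (card A) \<le> 2 powr (6 * sqrt \<epsilon> * real n)" .
qed

end
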